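(* The broadcast rate of the successive index coding (SIC) problem with conflict digraph $\mathcal D=(\mathcal V,\mathcal A)$ is upper bounded by $$\beta^{\rm SIC}(\mathcal D)\le\min_{\{\mathcal V_1,\dots,\mathcal V_s\}}\sum_{i=1}^s(m_i+1),$$ where the minimum is over all partitions $\{\mathcal V_1,\dots,\mathcal V_s\}$ of $\mathcal V$ and, for all $i=1,\dots,s$, $\mathcal D[\mathcal V_i]$ is a weakly $m_i$-degenerate set.
   Context: SIC problem. Let $\mathcal D=(\mathcal V,\mathcal A)$ be a finite digraph (conflict digraph) on $\mathcal V=\{1,\dots,n\}$. A transmitter holds messages $x_1,\dots,x_n$ with $x_i\in\{0,1\}^{t_i}$ and broadcasts a word in $\{0,1\}^r$ noiselessly to receivers $1,\dots,n$; receiver $j$ wants $x_j$ and initially knows $x_i$ for $i\in\mathcal S_j=\{i\ne j:(i,j)\notin\mathcal A\}$. Given a decoding order $\pi$ (a strict partial order $\prec_\pi$ on $\mathcal V$), receiver $j$ also gets $x_i$ for all $i\prec_\pi j$, so it knows $x(\mathcal S_j^\pi)$ with $\mathcal S_j^\pi=\mathcal S_j\cup\{i:i\prec_\pi j\}$. A code consists of an encoder $\phi:\prod_i\{0,1\}^{t_i}\to\{0,1\}^r$ and decoders $\psi_j^\pi$ with $\psi_j^\pi(\phi(x^n),x(\mathcal S_j^\pi))=x_j$ for all $j$ and all message tuples; $\mathcal R^\pi$ is the set of $(R_1,\dots,R_n)$ with $R_j\le t_j/r$ for all $j$ for some such code. The capacity region is $\mathscr C=\mathrm{conv}(\bigcup_\pi\mathcal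 R^\pi)$ and the broadcast rate is $\beta^{\rm SIC}(\mathcal D)=\inf\{b:(1/b,\dots,1/b)\in\mathscr C\}$. For a vertex set $\mathcal Q$, $\mathcal D[\mathcal Q]$ denotes the induced sub-digraph, and $d^-(\cdot,v)$, $d^+(\cdot,v)$ denote in-degree and out-degree. $\mathcal D[\mathcal Q]$ is a weakly $m$-degenerate set if for every nonempty $\mathcal Q'\subseteq\mathcal Q$ there is $v\in\mathcal Q'$ with $\min\{d^-(\mathcal D[\mathcal Q'],v),d^+(\mathcal D[\mathcal Q'],v)\}\le m$. *)

theory Defs
  imports
    "HOL-Analysis.Analysis"
    "HOL-Library.Disjoint_Sets"
    "Graph_Theory.Graph_Theory"
begin

(* The vertex set {1,...,n} is modelled by a finite type 'v, so that rate tuples live in real^'v.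
   The definitions below are meant for conflict digraphs with pverts D = UNIV. *)

definition words :: "nat \<Rightarrow> bool list set" where
  "words k = {w. length w = k}"

definition side_info :: "'v pair_pre_digraph \<Rightarrow> 'v \<Rightarrow> 'v set" where
  "side_info D j = {i. i \<noteq> j \<and> (i, j) \<notin> parcs D}"

(* (i, j) \<in> ord is read as "i precedes j". *)
definition decoding_orders :: "'v rel set" where
  "decoding_orders = {ord. irrefl ord \<and> trans ord}"

definition side_info_ord :: "'v pair_pre_digraph \<Rightarrow> 'v rel \<Rightarrow> 'v \<Rightarrow> 'v set" where
  "side_info_ord D ord j = side_info D j \<union> {i. (i, j) \<in> ord}"

definition sic_code ::
  "'v pair_pre_digraph \<Rightarrow> 'v rel \<Rightarrow> ('v \<Rightarrow> nat) \<Rightarrow> nat \<Rightarrow>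
    (('v \<Rightarrow> bool list) \<Rightarrow> bool list) \<Rightarrow>
    ('v \<Rightarrow> bool list \<Rightarrow> ('v \<Rightarrow> bool list) \<Rightarrow> bool list) \<Rightarrow> bool" where
  "sic_code D ord t r \<phi> \<psi> \<longleftrightarrow>
     \<phi> \<in> (\<Pi> i\<in>UNIV. words (t i)) \<rightarrow> words r \<and>
     (\<forall>j. \<psi> j \<in> words r \<rightarrow> (\<Pi>\<^sub>E i\<in>side_info_ord D ord j. words (t i)) \<rightarrow> words (t j)) \<and>
     (\<forall>x \<in> (\<Pi> i\<in>UNIV. words (t i)). \<forall>j.
        \<psi> j (\<phi> x) (restrict x (side_info_ord D ord j)) = x j)"

definition rate_region :: "'v::finite pair_pre_digraph \<Rightarrow> 'v rel \<Rightarrow> (real^'v) set" where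
  "rate_region D ord =
     {R. \<exists>t r \<phi> \<psi>. r > 0 \<and> sic_code D ord t r \<phi> \<psi> \<and> (\<forall>j. R $ j \<le> real (t j) / real r)}"

definition capacity_region :: "'v::finite pair_pre_digraph \<Rightarrow> (real^'v) set" where
  "capacity_region D = convex hull (\<Union>ord\<in>decoding_orders. rate_region D ord)"

(* The restriction b > 0 is needed because 1 / 0 = 0 and because rate regions are downward closed,
   hence contain negative tuples. *)
definition sic_broadcast_rate :: "'v::finite pair_pre_digraph \<Rightarrow> real" where
  "sic_broadcast_rate D = Inf {b. b > 0 \<and> (\<chi> j. 1 / b) \<in> capacity_region D}"

definition weakly_degenerate :: "nat \<Rightarrow> 'v pair_pre_digraph \<Rightarrow> 'v set \<Rightarrow> bool" where
  "weakly_degenerate m D Q \<longleftrightarrow>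
     (\<forall>Q'. Q' \<subseteq> Q \<and> Q' \<noteq> {} \<longrightarrow>
        (\<exists>v\<in>Q'. min (in_degree (with_proj D \<restriction> Q') v) (out_degree (with_proj D \<restriction> Q') v) \<le> m))"

(* m assigns to each block of the partition P its degeneracy parameter. *)
definition degenerate_partition ::
  "'v pair_pre_digraph \<Rightarrow> 'v set set \<Rightarrow> ('v set \<Rightarrow> nat) \<Rightarrow> bool" where
  "degenerate_partition D P m \<longleftrightarrow>
     partition_on (pverts D) P \<and> (\<forall>Q\<in>P. weakly_degenerate (m Q) D Q)"

(* Minima of natural-valued quantities over all degenerate partitions are therefore attained. *)
lemma degenerate_partition_exists:
  fixes D :: "'v::finite pair_pre_digraph"
  shows "\<exists>P m. degenerate_partition D P m"
proof -
  obtain P where P: "partition_on (pverts D) P"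
    using partition_on_singletons by blast
  have "weakly_degenerate (card (parcs D)) D Q" for Q
  proof -
    have "in_degree (with_proj D \<restriction> Q') v \<le> card (parcs D)" for Q' v
      unfolding in_degree_def in_arcs_def by (rule card_mono) auto
    then show ?thesis
      unfolding weakly_degenerate_def by (meson ex_in_conv min.coboundedI1)
  qed
  with P show ?thesis
    unfolding degenerate_partition_def
    by (intro exI[of _ P] exI[of _ "\<lambda>_. card (parcs D)"]) simp
qed

end

(* Build a decoding order for each block by deleting vertices v of small in- or out-degree one at a
   time: if the in-degree is small, decode v before the remaining vertices (then v does not disturb
   them), and if the out-degree is small, decode v after them (then they do not disturb v). In both
   cases at most m conflicts join v to the remaining vertices, so the conflicts that survive the
   order can be properly coloured with m + 1 colours. Using disjoint palettes for the blocks and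
   broadcasting the sum modulo 2 of the one-bit messages of each colour class yields a code whose
   length is the number of colours. *)
theory Submission
  imports Defs
begin

lemma weakly_degenerate_subset:
  assumes "weakly_degenerate m D Q" "Q' \<subseteq> Q"
  shows "weakly_degenerate m D Q'"
  using assms unfolding weakly_degenerate_def by (meson subset_trans)

text \<open>Arcs of \<open>with_proj D\<close> are pairs, so an in-neighbour in \<open>Q\<close> is
  the first component of an arc kept by the restriction.\<close>

lemma card_in_neighbours_le:
  fixes D :: "'v::finite pair_pre_digraph"
  assumes "v \<in> Q"
  shows "card {i \<in> Q. (i, v) \<in> parcs D} \<le> in_degree (with_proj D \<restriction> Q) v"
proof -
  have "{i \<in> Q. (i, v) \<in> parcs D} \<subseteq> fst ` in_arcs (with_proj D \<restriction> Q) v"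
    using assms by (force simp: in_arcs_def induce_subgraph_def image_iff)
  then show ?thesis
    unfolding in_degree_def by (meson finite card_image_le card_mono le_trans)
qed

lemma card_out_neighbours_le:
  fixes D :: "'v::finite pair_pre_digraph"
  assumes "v \<in> Q"
  shows "card {i \<in> Q. (v, i) \<in> parcs D} \<le> out_degree (with_proj D \<restriction> Q) v"
proof -
  have "{i \<in> Q. (v, i) \<in> parcs D} \<subseteq> snd ` out_arcs (with_proj D \<restriction> Q) v"
    using assms by (force simp: out_arcs_def induce_subgraph_def image_iff)
  then show ?thesis
    unfolding out_degree_def by (meson finite card_image_le card_mono le_trans)
qed

text \<open>An arc \<open>(i, j)\<close> inside a colour class must be resolved by the order:
  \<open>j\<close> then learns the message of \<open>i\<close> before decoding. The colour type is
  left open so that block-colour pairs can serve as colours.\<close>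

definition order_colouring ::
  "'v pair_pre_digraph \<Rightarrow> 'v set \<Rightarrow> 'v rel \<Rightarrow> ('v \<Rightarrow> 'c) \<Rightarrow> bool" where
  "order_colouring D Q ord col \<longleftrightarrow>
     ord \<subseteq> Q \<times> Q \<and> irrefl ord \<and> trans ord \<and>
     (\<forall>i\<in>Q. \<forall>j\<in>Q. i \<noteq> j \<longrightarrow> col i = col j \<longrightarrow> (i, j) \<in> parcs D \<longrightarrow> (i, j) \<in> ord)"

lemma weakly_degenerate_order_colouring:
  fixes D :: "'v::finite pair_pre_digraph"
  assumes "weakly_degenerate m D Q"
  shows "\<exists>ord (col :: 'v \<Rightarrow> nat). order_colouring D Q ord col \<and> col ` Q \<subseteq> {..m}"
  using finite[of Q] assms
proof (induction Q rule: finite_psubset_induct)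
  case (psubset Q)
  show ?case
  proof (cases "Q = {}")
    case True
    then show ?thesis
      by (auto simp: order_colouring_def irrefl_def intro!: exI[of _ "{}"])
  next
    case False
    with psubset.prems obtain v where v: "v \<in> Q"
      and deg: "min (in_degree (with_proj D \<restriction> Q) v) (out_degree (with_proj D \<restriction> Q) v) \<le> m"
      unfolding weakly_degenerate_def by blast
    define R where "R = Q - {v}"
    have Q: "Q = insert v R" and vR: "v \<notin> R" and "R \<subset> Q"
      using v by (auto simp: R_def)
    with psubset obtain ord and col :: "'v \<Rightarrow> nat"
      where oc: "order_colouring D R ord col" and col: "col ` R \<subseteq> {..m}"
      by (meson psubset_imp_subset weakly_degenerate_subset)
    have ord: "ord \<subseteq> R \<times> R" "irrefl ord" "trans ord"
      and arcs: "\<And>i j. i \<in> R \<Longrightarrow> j \<in> R \<Longrightarrow> i \<noteq> j \<Longrightarrow> col i = col j \<Longrightarrow> (i, j) \<in> parcs D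
        \<Longrightarrow> (i, j) \<in> ord"
      using oc by (auto simp: order_colouring_def)
    \<comment> \<open>Pigeonhole: \<open>m + 1\<close> colours against at most \<open>m\<close>
      forbidden ones.\<close>
    have fresh: "\<exists>c\<le>m. c \<notin> col ` N" if "card N \<le> m" for N
    proof -
      have "card (col ` N) < card {..m}"
        using that card_image_le[of N col] by simp
      then have "\<not> {..m} \<subseteq> col ` N"
        using card_mono[of "col ` N" "{..m}"] by auto
      then show ?thesis by blast
    qed
    consider (In) "card {i \<in> Q. (i, v) \<in> parcs D} \<le> m"
      | (Out) "card {i \<in> Q. (v, i) \<in> parcs D} \<le> m"
      using deg card_in_neighbours_le[OF v, of D] card_out_neighbours_le[OF v, of D] by linarith
    then show ?thesis
    proof cases
      case In
      then obtain c where c: "c \<le> m" "c \<notin> col ` {i \<in> Q. (i, v) \<in> parcs D}"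
        using fresh by blast
      \<comment> \<open>With \<open>v\<close> first, the order covers all arcs from \<open>v\<close>
        into \<open>R\<close>; the colour \<open>c\<close> separates \<open>v\<close> from the tails
        of arcs into \<open>v\<close>. Transitivity survives because nothing precedes
        \<open>v\<close>.\<close>
      have "trans (ord \<union> {v} \<times> R)"
        using ord vR unfolding trans_def by blast
      then have "order_colouring D Q (ord \<union> {v} \<times> R) (col(v := c))"
        using ord vR c arcs unfolding order_colouring_def Q irrefl_def by auto
      then show ?thesis
        using c col by (intro exI conjI) (auto simp: Q)
    next
      case Out
      then obtain c where c: "c \<le> m" "c \<notin> col ` {i \<in> Q. (v, i) \<in> parcs D}"
        using fresh by blast
      \<comment> \<open>The mirror image: \<open>v\<close> comes last, and \<open>c\<close> avoids
        the heads of arcs out of \<open>v\<close>.\<close>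
      have "trans (ord \<union> R \<times> {v})"
        using ord vR unfolding trans_def by blast
      then have "order_colouring D Q (ord \<union> R \<times> {v}) (col(v := c))"
        using ord vR c arcs unfolding order_colouring_def Q irrefl_def by auto
      then show ?thesis
        using c col by (intro exI conjI) (auto simp: Q)
    qed
  qed
qed

text \<open>Tagging each colour with its block makes the palettes disjoint, so two vertices of equal
  colour share a block and the order of that block resolves their conflict.\<close>

lemma order_colouring_Union:
  assumes P: "partition_on V P"
    and oc: "\<And>Q. Q \<in> P \<Longrightarrow> order_colouring D Q (ord Q) (col Q)"
    and B: "\<And>v. v \<in> V \<Longrightarrow> B v \<in> P \<and> v \<in> B v"
  shows "order_colouring D V (\<Union>Q\<in>P. ord Q) (\<lambda>v. (B v, col (B v) v))"
proof -
  have same: "Q = Q'" if "Q \<in> P" "Q' \<in> P" "v \<in> Q" "v \<in> Q'" for Q Q' v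
    using partition_onD2[OF P] that unfolding disjoint_def by blast
  have sub: "ord Q \<subseteq> Q \<times> Q" if "Q \<in> P" for Q
    using oc[OF that] by (simp add: order_colouring_def)
  have "(\<Union>Q\<in>P. ord Q) \<subseteq> V \<times> V"
    using sub partition_onD1[OF P] by blast
  moreover have "irrefl (\<Union>Q\<in>P. ord Q)"
    using oc by (auto simp: order_colouring_def irrefl_def)
  moreover have "trans (\<Union>Q\<in>P. ord Q)"
  proof (rule transI)
    fix x y z
    assume "(x, y) \<in> (\<Union>Q\<in>P. ord Q)" "(y, z) \<in> (\<Union>Q\<in>P. ord Q)"
    then obtain Q Q' where *: "Q \<in> P" "(x, y) \<in> ord Q" "Q' \<in> P" "(y, z) \<in> ord Q'"
      by blast
    \<comment> \<open>The middle vertex \<open>y\<close> lies in both blocks, and blocks are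
      disjoint.\<close>
    then have "Q' = Q"
      using same sub by blast
    moreover have "trans (ord Q)"
      using oc[OF \<open>Q \<in> P\<close>] by (simp add: order_colouring_def)
    ultimately show "(x, z) \<in> (\<Union>Q\<in>P. ord Q)"
      using * by (blast dest: transD)
  qed
  moreover have "(i, j) \<in> (\<Union>Q\<in>P. ord Q)"
    if "i \<in> V" "j \<in> V" "i \<noteq> j" "(B i, col (B i) i) = (B j, col (B j) j)" "(i, j) \<in> parcs D"
    for i j
  proof -
    have eq: "B j = B i" "col (B i) i = col (B i) j"
      using that by (metis prod.inject)+
    have "i \<in> B i" "j \<in> B i"
      using B[of i] B[of j] that eq(1) by simp_all
    then have "(i, j) \<in> ord (B i)"
      using oc[of "B i"] B[of i] that eq(2) unfolding order_colouring_def by blast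
    then show ?thesis
      using B[of i] that by blast
  qed
  ultimately show ?thesis
    unfolding order_colouring_def by blast
qed

text \<open>The decoding rule: the parity of a class and its parity without \<open>a\<close> differ
  exactly by the bit of \<open>a\<close>.\<close>

lemma odd_card_remove:
  assumes "finite A"
  shows "odd (card A) \<noteq> odd (card (A - {a})) \<longleftrightarrow> a \<in> A"
proof (cases "a \<in> A")
  case True
  then show ?thesis
    using card.remove[OF assms True] by simp
qed simp

lemma order_colouring_sic_code:
  fixes D :: "'v::finite pair_pre_digraph" and col :: "'v \<Rightarrow> nat"
  assumes oc: "order_colouring D UNIV ord col" and col: "range col \<subseteq> {..<r}"
  shows "\<exists>\<phi> \<psi>. sic_code D ord (\<lambda>_. 1) r \<phi> \<psi>"
proof -
  define \<phi> :: "('v \<Rightarrow> bool list) \<Rightarrow> bool list"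
    where "\<phi> x = map (\<lambda>k. odd (card {i. col i = k \<and> x i = [True]})) [0..<r]" for x
  define \<psi> :: "'v \<Rightarrow> bool list \<Rightarrow> ('v \<Rightarrow> bool list) \<Rightarrow> bool list"
    where "\<psi> j w y = [w ! col j \<noteq> odd (card {i. i \<noteq> j \<and> col i = col j \<and> y i = [True]})]" for j w y
  have "\<psi> j (\<phi> x) (restrict x (side_info_ord D ord j)) = x j"
    if x: "\<And>i. length (x i) = 1" for x j
  proof -
    \<comment> \<open>Either \<open>(i, j)\<close> is no arc and \<open>i\<close> is side
      information, or the colouring puts \<open>i\<close> before \<open>j\<close>. Hence
      \<open>restrict\<close> never yields \<open>undefined\<close> on the class members that
      \<open>\<psi>\<close> reads.\<close>
    have known: "i \<in> side_info_ord D ord j" if "i \<noteq> j" "col i = col j" for i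
      using oc that unfolding order_colouring_def side_info_ord_def side_info_def by blast
    define A where "A = {i. col i = col j \<and> x i = [True]}"
    have "{i. i \<noteq> j \<and> col i = col j \<and> restrict x (side_info_ord D ord j) i = [True]} = A - {j}"
      using known by (auto simp: A_def)
    moreover have "\<phi> x ! col j = odd (card A)"
      using col by (simp add: \<phi>_def A_def image_subset_iff)
    ultimately have "\<psi> j (\<phi> x) (restrict x (side_info_ord D ord j)) = [j \<in> A]"
      using odd_card_remove[of A j] by (simp add: \<psi>_def)
    \<comment> \<open>A word of length 1 is \<open>[True]\<close> or \<open>[False]\<close>.\<close>
    also have "\<dots> = x j"
      using x[of j] by (auto simp: A_def length_Suc_conv)
    finally show ?thesis .
  qed
  then have "sic_code D ord (\<lambda>_. 1) r \<phi> \<psi>"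
    unfolding sic_code_def words_def by (auto simp: \<phi>_def \<psi>_def Pi_iff)
  then show ?thesis by blast
qed

lemma sic_broadcast_rate_le_card:
  fixes D :: "'v::finite pair_pre_digraph" and col :: "'v \<Rightarrow> 'c"
  assumes oc: "order_colouring D UNIV ord col" and C: "finite C" "range col \<subseteq> C"
  shows "sic_broadcast_rate D \<le> real (card C)"
proof -
  \<comment> \<open>Renumbering turns colours into positions of the broadcast word.\<close>
  obtain h where h: "bij_betw h C {0..<card C}"
    using ex_bij_betw_finite_nat[OF C(1)] by blast
  have "inj_on h (range col)"
    using h C(2) by (meson bij_betw_imp_inj_on inj_on_subset)
  then have "order_colouring D UNIV ord (h \<circ> col)"
    using oc by (auto simp: order_colouring_def inj_on_eq_iff)
  moreover have "range (h \<circ> col) \<subseteq> {..<card C}"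
    using bij_betw_imp_surj_on[OF h] C(2) by (auto simp: atLeast0LessThan)
  ultimately obtain \<phi> \<psi> where code: "sic_code D ord (\<lambda>_. 1) (card C) \<phi> \<psi>"
    using order_colouring_sic_code by blast
  \<comment> \<open>The vertex type is inhabited, so some colour is used.\<close>
  have pos: "card C > 0"
    using C by (auto simp: card_gt_0_iff)
  have "(\<chi> j. 1 / real (card C)) \<in> rate_region D ord"
    unfolding rate_region_def using code pos
    by (intro CollectI exI[of _ "\<lambda>_. 1"] exI[of _ "card C"] exI[of _ \<phi>] exI[of _ \<psi>]) simp
  moreover have "ord \<in> decoding_orders"
    using oc by (simp add: order_colouring_def decoding_orders_def)
  ultimately have "(\<chi> j. 1 / real (card C)) \<in> capacity_region D"
    unfolding capacity_region_def by (blast intro: hull_inc)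
  then show ?thesis
    \<comment> \<open>The constraint \<open>b > 0\<close> makes 0 a lower bound, so the infimum lies
      below every member.\<close>
    unfolding sic_broadcast_rate_def using pos
    by (intro cInf_lower) (auto intro!: bdd_belowI[of _ 0])
qed

lemma sic_broadcast_rate_le_degenerate_partition:
  fixes D :: "'v::finite pair_pre_digraph"
  assumes V: "pverts D = UNIV" and dp: "degenerate_partition D P m"
  shows "sic_broadcast_rate D \<le> real (\<Sum>Q\<in>P. (m Q + 1))"
proof -
  have P: "partition_on UNIV P" and wd: "\<And>Q. Q \<in> P \<Longrightarrow> weakly_degenerate (m Q) D Q"
    using dp V by (auto simp: degenerate_partition_def)
  obtain ord and col :: "'v set \<Rightarrow> 'v \<Rightarrow> nat"
    where oc: "\<And>Q. Q \<in> P \<Longrightarrow> order_colouring D Q (ord Q) (col Q)"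
      and col: "\<And>Q. Q \<in> P \<Longrightarrow> col Q ` Q \<subseteq> {..m Q}"
    using weakly_degenerate_order_colouring[OF wd] by metis
  have "\<forall>v. \<exists>Q. Q \<in> P \<and> v \<in> Q"
    using partition_onD1[OF P] by blast
  then obtain B where B: "\<And>v. B v \<in> P \<and> v \<in> B v"
    using choice[of "\<lambda>v Q. Q \<in> P \<and> v \<in> Q"] by blast
  \<comment> \<open>The palette is the disjoint union of the block palettes; the colours
    \<open>0\<close> to \<open>m Q\<close> contribute \<open>m Q + 1\<close> each.\<close>
  have "sic_broadcast_rate D \<le> real (card (SIGMA Q:P. {..m Q}))"
  proof (rule sic_broadcast_rate_le_card)
    show "order_colouring D UNIV (\<Union>Q\<in>P. ord Q) (\<lambda>v. (B v, col (B v) v))"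
      using order_colouring_Union[OF P oc B] .
    show "range (\<lambda>v. (B v, col (B v) v)) \<subseteq> (SIGMA Q:P. {..m Q})"
      using B col by blast
  qed simp
  also have "card (SIGMA Q:P. {..m Q}) = (\<Sum>Q\<in>P. (m Q + 1))"
    by simp
  finally show ?thesis .
qed

theorem lemma5:
  fixes D :: "'v::finite pair_pre_digraph"
  assumes "pair_digraph D" and "pverts D = UNIV"
  shows "sic_broadcast_rate D
    \<le> real (LEAST c. \<exists>P m. degenerate_partition D P m \<and> c = (\<Sum>Q\<in>P. (m Q + 1)))"
proof -
  let ?p = "\<lambda>c. \<exists>P m. degenerate_partition D P m \<and> c = (\<Sum>Q\<in>P. (m Q + 1))"
  \<comment> \<open>Existence of a degenerate partition ensures that the \<open>LEAST\<close> value
    is attained.\<close>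
  have "\<exists>c. ?p c"
    using degenerate_partition_exists[of D] by blast
  then have "?p (LEAST c. ?p c)"
    by (rule LeastI_ex)
  then obtain P m where "degenerate_partition D P m" "(LEAST c. ?p c) = (\<Sum>Q\<in>P. (m Q + 1))"
    by blast
  then show ?thesis
    using sic_broadcast_rate_le_degenerate_partition[OF assms(2)] by metis
qed

end
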